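(* Let $\mathcal{A}$ be a unital Banach algebra and let $a\in\mathcal{A}$ and $b,c\in\hat{\mathcal{A}}$ be such that $a$ is $(b,c)$-invertible and $a^{-(b,c)}\neq0$. Suppose that $(a_n)_{n\in\mathbb{N}}\subset\mathcal{A}$ and $(b_n)_{n\in\mathbb{N}},(c_n)_{n\in\mathbb{N}}\subset\hat{\mathcal{A}}$ are sequences such that $a_n$ is $(b_n,c_n)$-invertible for each $n\in\mathbb{N}$. If $(a_n)_{n\in\mathbb{N}}$ converges to $a$, then the following statements are equivalent (limits as $n\to\infty$). (i) $a_n^{-(b_n,c_n)}\to a^{-(b,c)}$. (ii) $a_n^{-(b_n,c_n)}a_n\to a^{-(b,c)}a$ and $a_na_n^{-(b_n,c_n)}\to aa^{-(b,c)}$. (iii) $a_n^{-(b_n,c_n)}a_n\to a^{-(b,c)}a$ and $\widehat{\delta}((c_n)^{-1}(0),c^{-1}(0))\to0$. (iv) $a_na_n^{-(b_n,c_n)}\to aa^{-(b,c)}$ and $\widehat{\delta}(b_n\mathcal{A},b\mathcal{A})\to0$. (v) $\widehat{\delta}(b_n\mathcal{A},b\mathcal{A})\to0$ and $\widehat{\delta}((c_n)^{-1}(0),c^{-1}(0))\to0$. (vi) $\widehat{\delta}(a_n^{-(b_n,c_n)}\mathcal{A},a^{-(b,c)}\mathcal{A})\to0$ and $\widehat{\delta}((a_n^{-(b_n,c_n)})^{-1}(0),(a^{-(b,c)})^{-1}(0))\to0$. (vii) $a_na_n^{-(b_n,c_n)}\to aa^{-(b,c)}$ and $\widehat{\delta}((b_n)_{-1}(0),b_{-1}(0))\to0$.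 (viii) $a_n^{-(b_n,c_n)}a_n\to a^{-(b,c)}a$ and $\widehat{\delta}(\mathcal{A}c_n,\mathcal{A}c)\to0$. (ix) $\widehat{\delta}(\mathcal{A}c_n,\mathcal{A}c)\to0$ and $\widehat{\delta}((b_n)_{-1}(0),b_{-1}(0))\to0$. (x) $\widehat{\delta}(\mathcal{A}a_n^{-(b_n,c_n)},\mathcal{A}a^{-(b,c)})\to0$ and $\widehat{\delta}((a_n^{-(b_n,c_n)})_{-1}(0),(a^{-(b,c)})_{-1}(0))\to0$.
   Context: $\hat{\mathcal{A}}$ is the set of regular elements of $\mathcal{A}$ ($x=xyx$ for some $y\in\mathcal{A}$). For $b,c\in\mathcal{A}$, $a\in\mathcal{A}$ is $(b,c)$-invertible if there exists $y\in\mathcal{A}$ such that $y\in (b\mathcal{A}y)\cap(y\mathcal{A}c)$, $b=yab$ and $c=cay$; such $y$ is unique when it exists and is denoted $a^{-(b,c)}$. For $x\in\mathcal{A}$: $x\mathcal{A}=\{xz:z\in\mathcal{A}\}$, $\mathcal{A}x=\{zx:z\in\mathcal{A}\}$, $x^{-1}(0)=\{z\in\mathcal{A}: xz=0\}$, $x_{-1}(0)=\{z\in\mathcal{A}: zx=0\}$. The unit of $\mathcal{A}$ has norm one. For closed subspaces $\mathcal{M},\mathcal{N}$ of a Banach space, $\delta(\mathcal{M},\mathcal{N})=0$ if $\mathcal{M}=0$, otherwise $\delta(\mathcal{M},\mathcal{N})=\sup\{\mathrm{dist}(x,\mathcal{N}): x\in\mathcal{M},\|x\|=1\}$; the gap is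 $\widehat{\delta}(\mathcal{M},\mathcal{N})=\max\{\delta(\mathcal{M},\mathcal{N}),\delta(\mathcal{N},\mathcal{M})\}$. *)

theory Defs
  imports "HOL-Analysis.Analysis"
begin

text \<open>
  A unital Banach algebra whose unit has norm one is a type of sort
  \<open>{real_normed_algebra_1, banach}\<close>. Scalars are real; a complex algebra is covered by
  restriction of scalars, since none of the notions below mentions the scalar field.
\<close>

definition regular :: "'a::monoid_mult \<Rightarrow> bool" where
  "regular x \<longleftrightarrow> (\<exists>y. x = x * y * x)"

definition right_ideal_of :: "'a::monoid_mult \<Rightarrow> 'a set" where
  "right_ideal_of x = {x * z | z. True}"

definition left_ideal_of :: "'a::monoid_mult \<Rightarrow> 'a set" where
  "left_ideal_of x = {z * x | z. True}"

text \<open>\<open>x\<^sup>-\<^sup>1(0)\<close>, the kernel of left multiplication by \<open>x\<close>.\<close>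

definition right_annihilator :: "'a::ring_1 \<Rightarrow> 'a set" where
  "right_annihilator x = {z. x * z = 0}"

text \<open>\<open>x\<^sub>-\<^sub>1(0)\<close>, the kernel of right multiplication by \<open>x\<close>.\<close>

definition left_annihilator :: "'a::ring_1 \<Rightarrow> 'a set" where
  "left_annihilator x = {z. z * x = 0}"

definition is_bc_inverse :: "'a::monoid_mult \<Rightarrow> 'a \<Rightarrow> 'a \<Rightarrow> 'a \<Rightarrow> bool" where
  "is_bc_inverse b c a y \<longleftrightarrow>
     y \<in> {b * z * y | z. True} \<inter> {y * z * c | z. True} \<and> b = y * a * b \<and> c = c * a * y"

definition bc_invertible :: "'a::monoid_mult \<Rightarrow> 'a \<Rightarrow> 'a \<Rightarrow> bool" where
  "bc_invertible b c a \<longleftrightarrow> (\<exists>y. is_bc_inverse b c a y)"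

definition bc_inverse :: "'a::monoid_mult \<Rightarrow> 'a \<Rightarrow> 'a \<Rightarrow> 'a" where
  "bc_inverse b c a = (THE y. is_bc_inverse b c a y)"

lemma is_bc_inverse_unique:
  assumes y: "is_bc_inverse b c a y" and y': "is_bc_inverse b c a y'"
  shows "y = y'"
proof -
  from y obtain w where w: "y = y * w * c"
    unfolding is_bc_inverse_def by blast
  from y' obtain u where u: "y' = b * u * y'"
    unfolding is_bc_inverse_def by blast
  have b: "b = y * a * b" and c: "c = c * a * y'"
    using y y' unfolding is_bc_inverse_def by auto
  have "y = y * w * (c * a * y')" using w c by simp
  also have "\<dots> = y * a * y'" using w by (metis mult.assoc)
  also have "\<dots> = y * a * (b * u * y')" using u by simp
  also have "\<dots> = y'" using b u by (metis mult.assoc)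
  finally show ?thesis .
qed

lemma is_bc_inverse_bc_inverse:
  assumes "bc_invertible b c a"
  shows "is_bc_inverse b c a (bc_inverse b c a)"
  using assms is_bc_inverse_unique
  unfolding bc_invertible_def bc_inverse_def by (metis theI)

text \<open>
  The two functions below are only meaningful for subspaces; there the supremum is taken over a
  set that is bounded by 1, and nonempty whenever \<open>M \<noteq> {0}\<close>.
\<close>

definition subspace_delta :: "'a::real_normed_vector set \<Rightarrow> 'a set \<Rightarrow> real" where
  "subspace_delta M N = (if M = {0} then 0 else (SUP x\<in>{x \<in> M. norm x = 1}. infdist x N))"

definition subspace_gap :: "'a::real_normed_vector set \<Rightarrow> 'a set \<Rightarrow> real" where
  "subspace_gap M N = max (subspace_delta M N) (subspace_delta N M)"

end

theory Submission
  imports Defs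
begin

text \<open>
  Write \<open>y\<close> and \<open>y\<^sub>n\<close> for the inverses of \<open>a\<close> and \<open>a\<^sub>n\<close>. They are outer inverses, so \<open>ya\<close> and
  \<open>ay\<close> are idempotent, and the ideals and annihilators of \<open>b\<close> and \<open>c\<close> occurring in the theorem
  coincide with those of \<open>y\<close>, that is, with the ranges and kernels of these idempotents.
  Everything follows from the identity
  \<open>y\<^sub>n - y = y\<^sub>n(1 - ay) + (y\<^sub>na\<^sub>ny - y) - y\<^sub>n(a\<^sub>n - a)y\<close>: each of the assumptions makes
  one of the first two terms \<open>o(1 + \<parallel>y\<^sub>n\<parallel>)\<close>, which suffices for \<open>y\<^sub>n \<longlonglongrightarrow> y\<close> because an
  error \<open>o(1 + \<parallel>y\<^sub>n\<parallel>)\<close> forces \<open>y\<^sub>n\<close> to be bounded. Conversely, the gap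
  between the ranges, or the kernels, of two idempotents is at most their distance.
\<close>

section \<open>The gap between subspaces\<close>

lemma bdd_above_infdist_unit_sphere:
  fixes M N :: "'a::real_normed_vector set"
  assumes "0 \<in> N"
  shows "bdd_above ((\<lambda>x. infdist x N) ` {x \<in> M. norm x = 1})"
proof (rule bdd_aboveI2)
  fix x assume "x \<in> {x \<in> M. norm x = 1}"
  then show "infdist x N \<le> 1"
    using infdist_le[OF assms, of x] by simp
qed

lemma subspace_unit_vector:
  fixes M :: "'a::real_normed_vector set"
  assumes "subspace M" "M \<noteq> {0}"
  obtains x where "x \<in> M" "norm x = 1"
proof -
  obtain x where x: "x \<in> M" "x \<noteq> 0"
    using assms subspace_0 by blast
  show ?thesis
    using x assms(1) by (intro that[of "x /\<^sub>R norm x"]) (auto simp: subspace_scale)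
qed

text \<open>Upper estimates for the gap come from an explicit approximant in \<open>N\<close>. The
  assumption \<open>0 \<le> K\<close> covers the zero subspace, where \<open>subspace_delta\<close>
  is 0 by convention.\<close>

lemma subspace_delta_le:
  fixes M N :: "'a::real_normed_vector set"
  assumes M: "subspace M" and K: "0 \<le> K"
    and approx: "\<And>x. x \<in> M \<Longrightarrow> \<exists>w\<in>N. norm (x - w) \<le> K * norm x"
  shows "subspace_delta M N \<le> K"
proof (cases "M = {0}")
  case False
  obtain x where "x \<in> M" "norm x = 1"
    using M False by (rule subspace_unit_vector)
  then have "{x \<in> M. norm x = 1} \<noteq> {}" by blast
  then have "(SUP x\<in>{x \<in> M. norm x = 1}. infdist x N) \<le> K"
  proof (rule cSUP_least)
    fix x assume "x \<in> {x \<in> M. norm x = 1}"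
    then obtain w where "w \<in> N" "norm (x - w) \<le> K"
      using approx[of x] by auto
    then show "infdist x N \<le> K"
      using infdist_le[of w N x] by (simp add: dist_norm)
  qed
  then show ?thesis using False by (simp add: subspace_delta_def)
qed (simp add: subspace_delta_def K)

lemma infdist_le_subspace_delta:
  fixes M N :: "'a::real_normed_vector set"
  assumes "0 \<in> N" "x \<in> M" "norm x = 1"
  shows "infdist x N \<le> subspace_delta M N"
proof -
  have "M \<noteq> {0}" using assms by auto
  then show ?thesis
    unfolding subspace_delta_def
    using cSUP_upper[OF _ bdd_above_infdist_unit_sphere[OF assms(1)], of x M] assms by simp
qed

lemma subspace_delta_nonneg:
  fixes M N :: "'a::real_normed_vector set"
  assumes "subspace M" "subspace N"
  shows "0 \<le> subspace_delta M N"
proof (cases "M = {0}")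
  case False
  obtain x where "x \<in> M" "norm x = 1"
    using assms(1) False by (rule subspace_unit_vector)
  then show ?thesis
    using infdist_le_subspace_delta[OF subspace_0[OF assms(2)]] infdist_nonneg order_trans
    by metis
qed (simp add: subspace_delta_def)

lemma subspace_gap_nonneg:
  fixes M N :: "'a::real_normed_vector set"
  assumes "subspace M" "subspace N"
  shows "0 \<le> subspace_gap M N"
  using subspace_delta_nonneg[OF assms] by (simp add: subspace_gap_def)

text \<open>This is how a small gap is exploited. For a unit vector \<open>u\<close>,
  \<open>f u = f (u - w)\<close> for every \<open>w\<close> in \<open>N\<close>, so
  \<open>norm (f u)\<close> is at most \<open>K\<close> times the distance from \<open>u\<close> to
  \<open>N\<close>; homogeneity does the rest.\<close>

lemma norm_le_subspace_delta:
  fixes M N :: "'a::real_normed_vector set" and f :: "'a \<Rightarrow> 'b::real_normed_vector"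
  assumes M: "subspace M" and N: "subspace N" and f: "linear f"
    and bound: "\<And>z. norm (f z) \<le> K * norm z"
    and vanish: "\<And>z. z \<in> N \<Longrightarrow> f z = 0" and x: "x \<in> M"
  shows "norm (f x) \<le> K * norm x * subspace_delta M N"
proof (cases "x = 0")
  case False
  define u where "u = x /\<^sub>R norm x"
  have u: "u \<in> M" "norm u = 1"
    using x False M by (auto simp: u_def subspace_scale)
  have K: "0 \<le> K"
    using bound[of u] u(2) norm_ge_zero[of "f u"] by (simp del: norm_ge_zero)
  have "norm (f u) \<le> K * infdist u N"
  \<comment> \<open>The infimum over \<open>w\<close> is taken after dividing by \<open>K\<close>,
    hence the case split.\<close>
  proof (cases "K = 0")
    case False
    with K have "K > 0" by simp
    have "norm (f u) / K \<le> dist u w" if "w \<in> N" for w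
    proof -
      have "f u = f (u - w)" using vanish[OF that] by (simp add: linear_diff[OF f])
      then show ?thesis
        using bound[of "u - w"] \<open>K > 0\<close> by (simp add: dist_norm divide_le_eq mult.commute)
    qed
    moreover have "N \<noteq> {}" using subspace_0[OF N] by blast
    ultimately have "norm (f u) / K \<le> infdist u N"
      by (simp add: infdist_notempty cINF_greatest)
    then show ?thesis using \<open>K > 0\<close> by (simp add: divide_le_eq mult.commute)
  qed (use bound[of u] in simp)
  also have "\<dots> \<le> K * subspace_delta M N"
    using K infdist_le_subspace_delta[OF subspace_0[OF N] u] by (simp add: mult_left_mono)
  finally have "norm x * norm (f u) \<le> norm x * (K * subspace_delta M N)"
    by (simp add: mult_left_mono)
  moreover have "f x = norm x *\<^sub>R f u"
    using False by (simp add: u_def linear_scale[OF f])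
  ultimately show ?thesis by (simp add: ac_simps)
qed (simp add: linear_0[OF f])

section \<open>Outer inverses\<close>

text \<open>The weight \<open>1 + norm (Y n)\<close> never vanishes and absorbs both null errors and
  null errors multiplied by \<open>norm (Y n)\<close>.\<close>

lemma tendsto_relative_error:
  fixes Z Y :: "nat \<Rightarrow> 'a::real_normed_vector"
  assumes "\<And>n. norm (Z n) \<le> (1 + norm (Y n)) * \<alpha> n" "\<alpha> \<longlonglongrightarrow> 0"
  shows "(\<lambda>n. Z n /\<^sub>R (1 + norm (Y n))) \<longlonglongrightarrow> 0"
proof (rule Lim_null_comparison[OF always_eventually assms(2)], rule allI)
  fix n
  have "0 < 1 + norm (Y n)" by (simp add: add_pos_nonneg)
  then show "norm (Z n /\<^sub>R (1 + norm (Y n))) \<le> \<alpha> n"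
    using assms(1)[of n] by (simp add: field_simps)
qed

text \<open>Boundedness of \<open>Y\<close> is a consequence: once the relative error is below 1/2,
  the triangle inequality lets \<open>norm (Y n)\<close> be absorbed into the left side, giving
  \<open>1 + norm (Y n) \<le> 2 + 2 * norm y\<close>.\<close>

lemma tendsto_of_relative_error:
  fixes Y :: "nat \<Rightarrow> 'a::real_normed_vector"
  assumes "(\<lambda>n. (Y n - y) /\<^sub>R (1 + norm (Y n))) \<longlonglongrightarrow> 0" (is "?t \<longlonglongrightarrow> 0")
  shows "Y \<longlonglongrightarrow> y"
proof -
  have "\<forall>\<^sub>F n in sequentially. norm (?t n) < 1/2"
    using order_tendstoD(2)[OF tendsto_norm_zero[OF assms], of "1/2"] by simp
  then have "\<forall>\<^sub>F n in sequentially. norm (Y n - y) \<le> (2 + 2 * norm y) * norm (?t n)"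
  proof eventually_elim
    case (elim n)
    have pos: "0 < 1 + norm (Y n)" by (simp add: add_pos_nonneg)
    have eq: "norm (Y n - y) = (1 + norm (Y n)) * norm (?t n)" using pos by simp
    have "(1 + norm (Y n)) * norm (?t n) \<le> (1 + norm (Y n)) * (1/2)"
      using elim pos by (intro mult_left_mono) auto
    with eq have "norm (Y n - y) \<le> (1 + norm (Y n)) / 2" by linarith
    moreover have "norm (Y n) \<le> norm y + norm (Y n - y)" by norm
    ultimately have "1 + norm (Y n) \<le> 2 + 2 * norm y" by argo
    then have "(1 + norm (Y n)) * norm (?t n) \<le> (2 + 2 * norm y) * norm (?t n)"
      by (rule mult_right_mono) simp
    with eq show ?case by linarith
  qed
  moreover have "(\<lambda>n. (2 + 2 * norm y) * norm (?t n)) \<longlonglongrightarrow> 0"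
    by (rule tendsto_mult_right_zero[OF tendsto_norm_zero[OF assms]])
  ultimately have "(\<lambda>n. Y n - y) \<longlonglongrightarrow> 0"
    by (rule Lim_null_comparison)
  then show ?thesis by (rule LIM_zero_cancel)
qed

text \<open>
  The multiplication is a parameter, so that the statements on left ideals and left annihilators
  are those on right ideals and right annihilators in the opposite algebra.
\<close>

locale normed_algebra_mult = bounded_bilinear mul
  for mul :: "'a::real_normed_vector \<Rightarrow> 'a \<Rightarrow> 'a" (infixl "\<cdot>" 70) +
  fixes e :: 'a
  assumes assoc: "(x \<cdot> z) \<cdot> w = x \<cdot> (z \<cdot> w)"
    and unit_left: "e \<cdot> x = x" and unit_right: "x \<cdot> e = x"
    and norm_mul_le: "norm (x \<cdot> z) \<le> norm x * norm z"
begin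

section \<open>Ranges and kernels of outer inverses\<close>

definition ker :: "'a \<Rightarrow> 'a set" where
  "ker x = {z. x \<cdot> z = 0}"

lemma linear_mul: "linear ((\<cdot>) x)"
  by (rule bounded_linear.linear[OF bounded_linear_right])

lemma subspace_range: "subspace (range ((\<cdot>) x))"
  using linear_subspace_image[OF linear_mul subspace_UNIV] by simp

lemma subspace_ker: "subspace (ker x)"
  using linear_subspace_kernel[OF linear_mul[of x]] by (simp add: ker_def)

lemma range_outer_inverse:
  assumes "y \<cdot> a \<cdot> y = y" "x \<in> range ((\<cdot>) y)"
  shows "y \<cdot> a \<cdot> x = x"
  using assms by (auto simp flip: assoc)

lemma ker_outer_inverse:
  assumes "y \<cdot> a \<cdot> y = y"
  shows "x \<in> ker y \<longleftrightarrow> a \<cdot> y \<cdot> x = 0"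
proof
  assume "a \<cdot> y \<cdot> x = 0"
  then have "y \<cdot> a \<cdot> y \<cdot> x = 0" by (simp add: assoc zero_right)
  then show "x \<in> ker y" by (simp add: ker_def assms)
qed (simp add: ker_def assoc zero_right)

text \<open>The idempotent \<open>v \<cdot> d\<close> maps into the range of \<open>v\<close>, and
  \<open>y \<cdot> a\<close> fixes \<open>x\<close>. Approximating \<open>x\<close> by
  \<open>v \<cdot> d \<cdot> x\<close> thus leaves the error
  \<open>(y \<cdot> a - v \<cdot> d) \<cdot> x\<close>.\<close>

lemma subspace_delta_range_le:
  assumes y: "y \<cdot> a \<cdot> y = y" and v: "v \<cdot> d \<cdot> v = v"
  shows "subspace_delta (range ((\<cdot>) y)) (range ((\<cdot>) v)) \<le> norm (y \<cdot> a - v \<cdot> d)"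
proof (rule subspace_delta_le[OF subspace_range norm_ge_zero])
  fix x assume "x \<in> range ((\<cdot>) y)"
  then have "x - v \<cdot> (d \<cdot> x) = (y \<cdot> a - v \<cdot> d) \<cdot> x"
    using range_outer_inverse[OF y] by (simp add: diff_left assoc)
  then show "\<exists>w\<in>range ((\<cdot>) v). norm (x - w) \<le> norm (y \<cdot> a - v \<cdot> d) * norm x"
    using norm_mul_le by (intro bexI[of _ "v \<cdot> (d \<cdot> x)"]) auto
qed

text \<open>The complementary idempotent \<open>e - d \<cdot> v\<close> maps into the kernel of
  \<open>v\<close>. Since \<open>a \<cdot> y\<close> kills \<open>x\<close>, the error
  \<open>d \<cdot> v \<cdot> x\<close> is, up to sign,
  \<open>(a \<cdot> y - d \<cdot> v) \<cdot> x\<close>.\<close>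

lemma subspace_delta_ker_le:
  assumes y: "y \<cdot> a \<cdot> y = y" and v: "v \<cdot> d \<cdot> v = v"
  shows "subspace_delta (ker y) (ker v) \<le> norm (a \<cdot> y - d \<cdot> v)"
proof (rule subspace_delta_le[OF subspace_ker norm_ge_zero])
  fix x assume x: "x \<in> ker y"
  have "norm (d \<cdot> v \<cdot> x) = norm ((a \<cdot> y - d \<cdot> v) \<cdot> x)"
    using x ker_outer_inverse[OF y] by (simp add: diff_left)
  then have "norm (x - (x - d \<cdot> v \<cdot> x)) \<le> norm (a \<cdot> y - d \<cdot> v) * norm x"
    using norm_mul_le by simp
  moreover have "v \<cdot> (d \<cdot> v \<cdot> x) = v \<cdot> x"
    using v by (simp flip: assoc)
  then have "x - d \<cdot> v \<cdot> x \<in> ker v"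
    by (simp add: ker_def diff_right)
  ultimately show "\<exists>w\<in>ker v. norm (x - w) \<le> norm (a \<cdot> y - d \<cdot> v) * norm x"
    by blast
qed

lemma subspace_gap_range_le:
  assumes "y \<cdot> a \<cdot> y = y" "v \<cdot> d \<cdot> v = v"
  shows "subspace_gap (range ((\<cdot>) y)) (range ((\<cdot>) v)) \<le> norm (y \<cdot> a - v \<cdot> d)"
  using subspace_delta_range_le[OF assms] subspace_delta_range_le[OF assms(2,1)]
  by (simp add: subspace_gap_def norm_minus_commute)

lemma subspace_gap_ker_le:
  assumes "y \<cdot> a \<cdot> y = y" "v \<cdot> d \<cdot> v = v"
  shows "subspace_gap (ker y) (ker v) \<le> norm (a \<cdot> y - d \<cdot> v)"
  using subspace_delta_ker_le[OF assms] subspace_delta_ker_le[OF assms(2,1)]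
  by (simp add: subspace_gap_def norm_minus_commute)

end

section \<open>Convergence criteria for a sequence of outer inverses\<close>

locale outer_inverse_sequence = normed_algebra_mult mul e
  for mul :: "'a::real_normed_vector \<Rightarrow> 'a \<Rightarrow> 'a" (infixl "\<cdot>" 70) and e :: 'a +
  fixes a y :: 'a and A Y :: "nat \<Rightarrow> 'a"
  assumes outer: "y \<cdot> a \<cdot> y = y" and outer_seq: "Y n \<cdot> A n \<cdot> Y n = Y n"
    and A_tendsto: "A \<longlonglongrightarrow> a"
begin

text \<open>The first defect measures how far \<open>Y n\<close> is from killing
  \<open>e - a \<cdot> y\<close>, the second how far \<open>Y n \<cdot> A n\<close> is from fixing
  \<open>y\<close>. They are controlled separately below, each either by an idempotent or by a
  gap.\<close>

lemma tendsto_of_defects: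
  assumes ker: "(\<lambda>n. (Y n \<cdot> (e - a \<cdot> y)) /\<^sub>R (1 + norm (Y n))) \<longlonglongrightarrow> 0"
    and range: "(\<lambda>n. (Y n \<cdot> A n \<cdot> y - y) /\<^sub>R (1 + norm (Y n))) \<longlonglongrightarrow> 0"
  shows "Y \<longlonglongrightarrow> y"
proof (rule tendsto_of_relative_error)
  have perturb: "(\<lambda>n. (Y n \<cdot> ((A n - a) \<cdot> y)) /\<^sub>R (1 + norm (Y n))) \<longlonglongrightarrow> 0"
  proof (rule tendsto_relative_error)
    show "norm (Y n \<cdot> ((A n - a) \<cdot> y)) \<le> (1 + norm (Y n)) * norm ((A n - a) \<cdot> y)" for n
      using norm_mul_le[of "Y n" "(A n - a) \<cdot> y"] norm_ge_zero[of "(A n - a) \<cdot> y"]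
      by (simp add: ring_distribs del: norm_ge_zero)
    have "(\<lambda>n. A n - a) \<longlonglongrightarrow> 0" using A_tendsto by (rule LIM_zero)
    then show "(\<lambda>n. norm ((A n - a) \<cdot> y)) \<longlonglongrightarrow> 0"
      by (intro tendsto_norm_zero tendsto_left_zero)
  qed
  have "Y n - y = Y n \<cdot> (e - a \<cdot> y) + (Y n \<cdot> A n \<cdot> y - y) - Y n \<cdot> ((A n - a) \<cdot> y)" for n
    by (simp add: diff_right diff_left unit_right assoc)
  then have "(Y n - y) /\<^sub>R r = (Y n \<cdot> (e - a \<cdot> y)) /\<^sub>R r + (Y n \<cdot> A n \<cdot> y - y) /\<^sub>R r
      - (Y n \<cdot> ((A n - a) \<cdot> y)) /\<^sub>R r" for n r
    by (simp only: scaleR_right_distrib scaleR_right_diff_distrib)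
  then show "(\<lambda>n. (Y n - y) /\<^sub>R (1 + norm (Y n))) \<longlonglongrightarrow> 0"
    using tendsto_diff[OF tendsto_add[OF ker range] perturb] by (simp only: diff_0_right add_0_right)
qed

text \<open>Writing \<open>Y n\<close> as \<open>Y n \<cdot> A n \<cdot> Y n\<close> replaces the
  unit by \<open>A n \<cdot> Y n\<close>.\<close>

lemma ker_defect_of_idempotent:
  assumes "(\<lambda>n. A n \<cdot> Y n) \<longlonglongrightarrow> a \<cdot> y"
  shows "(\<lambda>n. (Y n \<cdot> (e - a \<cdot> y)) /\<^sub>R (1 + norm (Y n))) \<longlonglongrightarrow> 0"
proof (rule tendsto_relative_error)
  fix n
  have "Y n \<cdot> (e - a \<cdot> y) = Y n \<cdot> (A n \<cdot> Y n - a \<cdot> y)"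
    using outer_seq[of n] by (simp add: diff_right unit_right assoc)
  also have "norm \<dots> \<le> norm (Y n) * norm (A n \<cdot> Y n - a \<cdot> y)"
    by (rule norm_mul_le)
  also have "\<dots> \<le> (1 + norm (Y n)) * norm (A n \<cdot> Y n - a \<cdot> y)"
    by (simp add: mult_right_mono)
  finally show "norm (Y n \<cdot> (e - a \<cdot> y)) \<le> (1 + norm (Y n)) * norm (A n \<cdot> Y n - a \<cdot> y)" .
qed (intro tendsto_norm_zero LIM_zero assms)

text \<open>The element \<open>e - a \<cdot> y\<close> lies in \<open>ker y\<close>, while
  multiplication by \<open>Y n\<close> has norm at most \<open>norm (Y n)\<close> and vanishes on
  \<open>ker (Y n)\<close>.\<close>

lemma ker_defect_of_gap:
  assumes "(\<lambda>n. subspace_gap (ker (Y n)) (ker y)) \<longlonglongrightarrow> 0"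
  shows "(\<lambda>n. (Y n \<cdot> (e - a \<cdot> y)) /\<^sub>R (1 + norm (Y n))) \<longlonglongrightarrow> 0"
proof (rule tendsto_relative_error)
  fix n
  let ?g = "subspace_gap (ker (Y n)) (ker y)" and ?x = "e - a \<cdot> y"
  have x: "?x \<in> ker y"
    using outer by (simp add: ker_def diff_right unit_right assoc)
  have "norm (Y n \<cdot> ?x) \<le> norm (Y n) * norm ?x * subspace_delta (ker y) (ker (Y n))"
    by (rule norm_le_subspace_delta[OF subspace_ker subspace_ker linear_mul norm_mul_le _ x])
      (simp add: ker_def)
  also have "\<dots> \<le> (1 + norm (Y n)) * norm ?x * ?g"
    by (intro mult_mono) (auto simp: subspace_gap_def subspace_delta_nonneg subspace_ker)
  finally show "norm (Y n \<cdot> ?x) \<le> (1 + norm (Y n)) * (norm ?x * ?g)"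
    by (simp add: mult.assoc)
qed (rule tendsto_mult_right_zero[OF assms])

lemma range_defect_of_idempotent:
  assumes "(\<lambda>n. Y n \<cdot> A n) \<longlonglongrightarrow> y \<cdot> a"
  shows "(\<lambda>n. (Y n \<cdot> A n \<cdot> y - y) /\<^sub>R (1 + norm (Y n))) \<longlonglongrightarrow> 0"
proof (rule tendsto_relative_error)
  show "norm (Y n \<cdot> A n \<cdot> y - y) \<le> (1 + norm (Y n)) * norm (Y n \<cdot> A n \<cdot> y - y)" for n
    by (simp add: ring_distribs)
  have "(\<lambda>n. Y n \<cdot> A n \<cdot> y) \<longlonglongrightarrow> y \<cdot> a \<cdot> y"
    by (intro tendsto assms tendsto_const)
  then show "(\<lambda>n. norm (Y n \<cdot> A n \<cdot> y - y)) \<longlonglongrightarrow> 0"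
    unfolding outer by (intro tendsto_norm_zero LIM_zero)
qed

text \<open>The map \<open>?f\<close> vanishes on the range of \<open>Y n\<close> and is evaluated
  at \<open>y\<close>, which lies in its own range.\<close>

lemma range_defect_of_gap:
  assumes "(\<lambda>n. subspace_gap (range ((\<cdot>) (Y n))) (range ((\<cdot>) y))) \<longlonglongrightarrow> 0"
  shows "(\<lambda>n. (Y n \<cdot> A n \<cdot> y - y) /\<^sub>R (1 + norm (Y n))) \<longlonglongrightarrow> 0"
proof (rule tendsto_relative_error)
  fix n
  let ?g = "subspace_gap (range ((\<cdot>) (Y n))) (range ((\<cdot>) y))"
  let ?\<delta> = "subspace_delta (range ((\<cdot>) y)) (range ((\<cdot>) (Y n)))"
  let ?f = "\<lambda>x. Y n \<cdot> A n \<cdot> x - x"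
  have y: "y \<in> range ((\<cdot>) y)"
    using unit_right by (metis rangeI)
  \<comment> \<open>The estimate \<open>s * t + 1 \<le> (1 + s) * (1 + t)\<close> splits off the
    weight; the remaining factor \<open>1 + norm (A n)\<close> converges.\<close>
  have bound: "norm (?f x) \<le> (1 + norm (Y n)) * (1 + norm (A n)) * norm x" for x
  proof -
    have "norm (?f x) \<le> norm (Y n \<cdot> A n) * norm x + norm x"
      using norm_triangle_ineq4[of "Y n \<cdot> A n \<cdot> x" x] norm_mul_le[of "Y n \<cdot> A n" x] by simp
    also have "\<dots> \<le> norm (Y n) * norm (A n) * norm x + norm x"
      using mult_right_mono[OF norm_mul_le[of "Y n" "A n"], of "norm x"] by simp
    also have "\<dots> \<le> (1 + norm (Y n)) * (1 + norm (A n)) * norm x"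
      by (simp add: ring_distribs)
    finally show ?thesis .
  qed
  have "norm (?f y) \<le> (1 + norm (Y n)) * (1 + norm (A n)) * norm y * ?\<delta>"
  proof (rule norm_le_subspace_delta[OF subspace_range subspace_range _ bound _ y])
    show "linear ?f"
      by (intro linear_compose_sub linear_mul linear_ident)
    show "?f z = 0" if "z \<in> range ((\<cdot>) (Y n))" for z
      using range_outer_inverse[OF outer_seq that] by simp
  qed
  also have "\<dots> \<le> (1 + norm (Y n)) * (1 + norm (A n)) * norm y * ?g"
    by (intro mult_left_mono) (auto simp: subspace_gap_def)
  finally show "norm (?f y) \<le> (1 + norm (Y n)) * ((1 + norm (A n)) * norm y * ?g)"
    by (simp add: mult.assoc)
next
  have "(\<lambda>n. (1 + norm (A n)) * norm y * subspace_gap (range ((\<cdot>) (Y n))) (range ((\<cdot>) y)))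
    \<longlonglongrightarrow> (1 + norm a) * norm y * 0"
    by (intro tendsto_intros A_tendsto assms)
  then show "(\<lambda>n. (1 + norm (A n)) * norm y * subspace_gap (range ((\<cdot>) (Y n))) (range ((\<cdot>) y)))
    \<longlonglongrightarrow> 0" by simp
qed

lemma gap_range_tendsto:
  assumes "(\<lambda>n. Y n \<cdot> A n) \<longlonglongrightarrow> y \<cdot> a"
  shows "(\<lambda>n. subspace_gap (range ((\<cdot>) (Y n))) (range ((\<cdot>) y))) \<longlonglongrightarrow> 0"
proof (rule tendsto_sandwich[OF _ _ tendsto_const])
  show "(\<lambda>n. norm (Y n \<cdot> A n - y \<cdot> a)) \<longlonglongrightarrow> 0"
    by (intro tendsto_norm_zero LIM_zero assms)
qed (auto intro!: always_eventually subspace_gap_nonneg subspace_range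
      subspace_gap_range_le outer outer_seq)

lemma gap_ker_tendsto:
  assumes "(\<lambda>n. A n \<cdot> Y n) \<longlonglongrightarrow> a \<cdot> y"
  shows "(\<lambda>n. subspace_gap (ker (Y n)) (ker y)) \<longlonglongrightarrow> 0"
proof (rule tendsto_sandwich[OF _ _ tendsto_const])
  show "(\<lambda>n. norm (A n \<cdot> Y n - a \<cdot> y)) \<longlonglongrightarrow> 0"
    by (intro tendsto_norm_zero LIM_zero assms)
qed (auto intro!: always_eventually subspace_gap_nonneg subspace_ker
      subspace_gap_ker_le outer outer_seq)

lemma tendsto_idempotents:
  assumes "Y \<longlonglongrightarrow> y"
  shows "(\<lambda>n. Y n \<cdot> A n) \<longlonglongrightarrow> y \<cdot> a" "(\<lambda>n. A n \<cdot> Y n) \<longlonglongrightarrow> a \<cdot> y"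
  by (intro tendsto assms A_tendsto)+

text \<open>Two ways to control each defect give four criteria. Conversely, convergence of
  \<open>Y\<close> passes to both idempotents, and from these to the gaps.\<close>

lemma tendsto_iff:
  shows "Y \<longlonglongrightarrow> y \<longleftrightarrow>
      (\<lambda>n. Y n \<cdot> A n) \<longlonglongrightarrow> y \<cdot> a \<and> (\<lambda>n. A n \<cdot> Y n) \<longlonglongrightarrow> a \<cdot> y"
    and "Y \<longlonglongrightarrow> y \<longleftrightarrow>
      (\<lambda>n. Y n \<cdot> A n) \<longlonglongrightarrow> y \<cdot> a \<and> (\<lambda>n. subspace_gap (ker (Y n)) (ker y)) \<longlonglongrightarrow> 0"
    and "Y \<longlonglongrightarrow> y \<longleftrightarrow>
      (\<lambda>n. A n \<cdot> Y n) \<longlonglongrightarrow> a \<cdot> y \<and>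
      (\<lambda>n. subspace_gap (range ((\<cdot>) (Y n))) (range ((\<cdot>) y))) \<longlonglongrightarrow> 0"
    and "Y \<longlonglongrightarrow> y \<longleftrightarrow>
      (\<lambda>n. subspace_gap (range ((\<cdot>) (Y n))) (range ((\<cdot>) y))) \<longlonglongrightarrow> 0 \<and>
      (\<lambda>n. subspace_gap (ker (Y n)) (ker y)) \<longlonglongrightarrow> 0"
  using tendsto_of_defects tendsto_idempotents gap_range_tendsto gap_ker_tendsto
    ker_defect_of_idempotent ker_defect_of_gap range_defect_of_idempotent range_defect_of_gap
  by blast+

end

section \<open>Inverses along two elements\<close>

lemma right_ideal_of_eq_range: "right_ideal_of x = range ((*) x)"
  by (auto simp: right_ideal_of_def)

lemma left_ideal_of_eq_range: "left_ideal_of x = range (\<lambda>z. z * x)"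
  by (auto simp: left_ideal_of_def)

text \<open>Multiplication by \<open>y * a\<close> fixes \<open>b\<close>, hence also
  \<open>y\<close>, which is a right multiple of \<open>b\<close>.\<close>

lemma is_bc_inverse_outer:
  assumes "is_bc_inverse b c a y"
  shows "y * a * y = y"
proof -
  obtain u where u: "y = b * u * y" and b: "b = y * a * b"
    using assms unfolding is_bc_inverse_def by blast
  have "y * a * y = y * a * b * u * y" using u by (metis mult.assoc)
  then show ?thesis using u b by simp
qed

text \<open>Mutual divisibility: \<open>b = y * (a * b)\<close> and \<open>y = b * (u * y)\<close>
  give equal right ideals and left annihilators; \<open>c = (c * a) * y\<close> and
  \<open>y = (y * w) * c\<close> give equal left ideals and right annihilators.\<close>

lemma
  fixes b c a y :: "'a::ring_1"
  assumes "is_bc_inverse b c a y"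
  shows right_ideal_of_bc_inverse: "right_ideal_of b = right_ideal_of y"
    and left_ideal_of_bc_inverse: "left_ideal_of c = left_ideal_of y"
    and right_annihilator_bc_inverse: "right_annihilator c = right_annihilator y"
    and left_annihilator_bc_inverse: "left_annihilator b = left_annihilator y"
proof -
  obtain u w where u: "y = b * u * y" and w: "y = y * w * c"
    and b: "b = y * a * b" and c: "c = c * a * y"
    using assms unfolding is_bc_inverse_def by blast
  have u': "y * z = b * (u * y * z)" and b': "b * z = y * (a * b * z)" for z
    using u b by (metis mult.assoc)+
  have w': "z * y = (z * y * w) * c" and c': "z * c = (z * c * a) * y" for z
    using w c by (metis mult.assoc)+
  show "right_ideal_of b = right_ideal_of y"
    unfolding right_ideal_of_def using u' b' by blast
  show "left_ideal_of c = left_ideal_of y"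
    unfolding left_ideal_of_def using w' c' by blast
  have "c * z = c * a * (y * z)" "y * z = y * w * (c * z)" for z
    using w c by (metis mult.assoc)+
  then show "right_annihilator c = right_annihilator y"
    unfolding right_annihilator_def by (metis mult_zero_right)
  have "z * b = (z * y) * (a * b)" "z * y = (z * b) * (u * y)" for z
    using u b by (metis mult.assoc)+
  then show "left_annihilator b = left_annihilator y"
    unfolding left_annihilator_def by (metis mult_zero_left)
qed

theorem theorem5p3:
  fixes a b c :: "'a::{real_normed_algebra_1, banach}"
    and a' b' c' :: "nat \<Rightarrow> 'a"
  assumes "regular b" and "regular c"
    and "bc_invertible b c a" and "bc_inverse b c a \<noteq> 0"
    and "\<And>n. regular (b' n)" and "\<And>n. regular (c' n)"
    and "\<And>n. bc_invertible (b' n) (c' n) (a' n)"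
    and "a' \<longlonglongrightarrow> a"
  shows
    "((\<lambda>n. bc_inverse (b' n) (c' n) (a' n)) \<longlonglongrightarrow> bc_inverse b c a \<longleftrightarrow>
        (\<lambda>n. bc_inverse (b' n) (c' n) (a' n) * a' n) \<longlonglongrightarrow> bc_inverse b c a * a \<and>
        (\<lambda>n. a' n * bc_inverse (b' n) (c' n) (a' n)) \<longlonglongrightarrow> a * bc_inverse b c a) \<and>
     ((\<lambda>n. bc_inverse (b' n) (c' n) (a' n)) \<longlonglongrightarrow> bc_inverse b c a \<longleftrightarrow>
        (\<lambda>n. bc_inverse (b' n) (c' n) (a' n) * a' n) \<longlonglongrightarrow> bc_inverse b c a * a \<and>
        (\<lambda>n. subspace_gap (right_annihilator (c' n)) (right_annihilator c)) \<longlonglongrightarrow> 0) \<and>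
     ((\<lambda>n. bc_inverse (b' n) (c' n) (a' n)) \<longlonglongrightarrow> bc_inverse b c a \<longleftrightarrow>
        (\<lambda>n. a' n * bc_inverse (b' n) (c' n) (a' n)) \<longlonglongrightarrow> a * bc_inverse b c a \<and>
        (\<lambda>n. subspace_gap (right_ideal_of (b' n)) (right_ideal_of b)) \<longlonglongrightarrow> 0) \<and>
     ((\<lambda>n. bc_inverse (b' n) (c' n) (a' n)) \<longlonglongrightarrow> bc_inverse b c a \<longleftrightarrow>
        (\<lambda>n. subspace_gap (right_ideal_of (b' n)) (right_ideal_of b)) \<longlonglongrightarrow> 0 \<and>
        (\<lambda>n. subspace_gap (right_annihilator (c' n)) (right_annihilator c)) \<longlonglongrightarrow> 0) \<and>
     ((\<lambda>n. bc_inverse (b' n) (c' n) (a' n)) \<longlonglongrightarrow> bc_inverse b c a \<longleftrightarrow>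
        (\<lambda>n. subspace_gap (right_ideal_of (bc_inverse (b' n) (c' n) (a' n))) (right_ideal_of (bc_inverse b c a))) \<longlonglongrightarrow> 0 \<and>
        (\<lambda>n. subspace_gap (right_annihilator (bc_inverse (b' n) (c' n) (a' n))) (right_annihilator (bc_inverse b c a))) \<longlonglongrightarrow> 0) \<and>
     ((\<lambda>n. bc_inverse (b' n) (c' n) (a' n)) \<longlonglongrightarrow> bc_inverse b c a \<longleftrightarrow>
        (\<lambda>n. a' n * bc_inverse (b' n) (c' n) (a' n)) \<longlonglongrightarrow> a * bc_inverse b c a \<and>
        (\<lambda>n. subspace_gap (left_annihilator (b' n)) (left_annihilator b)) \<longlonglongrightarrow> 0) \<and>
     ((\<lambda>n. bc_inverse (b' n) (c' n) (a' n)) \<longlonglongrightarrow> bc_inverse b c a \<longleftrightarrow>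
        (\<lambda>n. bc_inverse (b' n) (c' n) (a' n) * a' n) \<longlonglongrightarrow> bc_inverse b c a * a \<and>
        (\<lambda>n. subspace_gap (left_ideal_of (c' n)) (left_ideal_of c)) \<longlonglongrightarrow> 0) \<and>
     ((\<lambda>n. bc_inverse (b' n) (c' n) (a' n)) \<longlonglongrightarrow> bc_inverse b c a \<longleftrightarrow>
        (\<lambda>n. subspace_gap (left_ideal_of (c' n)) (left_ideal_of c)) \<longlonglongrightarrow> 0 \<and>
        (\<lambda>n. subspace_gap (left_annihilator (b' n)) (left_annihilator b)) \<longlonglongrightarrow> 0) \<and>
     ((\<lambda>n. bc_inverse (b' n) (c' n) (a' n)) \<longlonglongrightarrow> bc_inverse b c a \<longleftrightarrow>
        (\<lambda>n. subspace_gap (left_ideal_of (bc_inverse (b' n) (c' n) (a' n))) (left_ideal_of (bc_inverse b c a))) \<longlonglongrightarrow> 0 \<and>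
        (\<lambda>n. subspace_gap (left_annihilator (bc_inverse (b' n) (c' n) (a' n))) (left_annihilator (bc_inverse b c a))) \<longlonglongrightarrow> 0)"
proof -
  define y where "y = bc_inverse b c a"
  define Y where "Y = (\<lambda>n. bc_inverse (b' n) (c' n) (a' n))"
  have y: "is_bc_inverse b c a y"
    unfolding y_def using assms(3) by (rule is_bc_inverse_bc_inverse)
  have Y: "is_bc_inverse (b' n) (c' n) (a' n) (Y n)" for n
    unfolding Y_def using assms(7) by (rule is_bc_inverse_bc_inverse)
  note outer = is_bc_inverse_outer[OF y] is_bc_inverse_outer[OF Y]
  interpret M: outer_inverse_sequence "(*)" 1 a y a' Y
  proof (intro outer_inverse_sequence.intro normed_algebra_mult.intro
      outer_inverse_sequence_axioms.intro normed_algebra_mult_axioms.intro bounded_bilinear_mult)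
  qed (use outer in \<open>auto simp: assms(8) mult.assoc norm_mult_ineq\<close>)
  \<comment> \<open>Reversing the product exchanges the idempotents \<open>y * a\<close> and
    \<open>a * y\<close>, so statements pairing \<open>a * y\<close> with left annihilators, or
    \<open>y * a\<close> with left ideals, are the mixed criteria here.\<close>
  interpret Op: outer_inverse_sequence "\<lambda>x z. z * x" 1 a y a' Y
  proof (intro outer_inverse_sequence.intro normed_algebra_mult.intro
      outer_inverse_sequence_axioms.intro normed_algebra_mult_axioms.intro
      bounded_bilinear.flip[OF bounded_bilinear_mult])
    show "norm (z * x) \<le> norm x * norm z" for x z :: 'a
      using norm_mult_ineq[of z x] by (simp add: mult.commute)
  qed (use outer in \<open>auto simp: assms(8) mult.assoc\<close>)
  have ker: "M.ker = right_annihilator" "Op.ker = left_annihilator"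
    by (auto simp: fun_eq_iff M.ker_def Op.ker_def right_annihilator_def left_annihilator_def)
  note sets = right_ideal_of_bc_inverse left_ideal_of_bc_inverse
    right_annihilator_bc_inverse left_annihilator_bc_inverse
  have inverse_eq: "bc_inverse b c a = y" "bc_inverse (b' n) (c' n) (a' n) = Y n" for n
    by (simp_all add: y_def Y_def)
  \<comment> \<open>Once all sets are expressed through \<open>y\<close> and \<open>Y n\<close>,
    (vi) coincides with (v) and (x) with (ix).\<close>
  show ?thesis
    unfolding inverse_eq sets[OF y] sets[OF Y]
    using M.tendsto_iff Op.tendsto_iff
    unfolding ker right_ideal_of_eq_range[symmetric] left_ideal_of_eq_range[symmetric]
    by blast
qed

end
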